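(* Let $\lVert\cdot\rVert_A$ and $\lVert\cdot\rVert_B$ be rearrangement-invariant Banach function norms over $([0,\infty),\lambda)$ and let $\lVert\cdot\rVert_{A'}$ and $\lVert\cdot\rVert_{B'}$ be their respective associate norms. Then there is a constant $C>0$ such that the associate norm $\lVert\cdot\rVert_{(WL(A,B))'}$ of $\lVert\cdot\rVert_{WL(A,B)}$ satisfies $$\lVert f\rVert_{(WL(A,B))'}\le\lVert f\rVert_{WL(A',B')}\le C\lVert f\rVert_{(WL(A,B))'}$$ for every $f\in M$. Consequently, the associate space satisfies $(WL(A,B))'=WL(A',B')$, up to equivalence of the defining functionals.
   Context: $\lambda$ is Lebesgue measure on $[0,\infty)$; $M$ is the set of extended complex-valued $\lambda$-measurable functions on $[0,\infty)$ (identified when equal a.e.), $M_+$ the non-negative ones. The non-increasing rearrangement of $f\in M$ is $f^*(t)=\inf\{s\ge 0:\lambda(\{|f|>s\})\le t\}$. A Banach function norm is a map $\lVert\cdot\rVert:M\to[0,\infty]$ with $\lVert\,|f|\,\rVert=\lVert f\rVert$ whose restriction to $M_+$ satisfies: (P1) it is positively homogeneous, $\lVert f\rVert=0\Leftrightarrow f=0$ a.e., and $\lVert f+g\rVert\le\lVert f\rVert+\lVert g\rVert$; (P2) $f\le g$ a.e. implies $\lVert f\rVert\le\lVert g\rVert$; (P3) $f_n\uparrow f$ a.e. implies $\lVert f_n\rVert\uparrow\lVert f\rVert$; (P4) $\lVert\chi_E\rVert<\infty$ whenever $\lambda(E)<\infty$; (P5) for every $E$ with $\lambda(E)<\infty$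 there is a finite $C_E$ with $\int_E f\,d\lambda\le C_E\lVert f\rVert$ for all $f\in M_+$. It is rearrangement-invariant (r.i.) if $f^*=g^*$ implies $\lVert f\rVert=\lVert g\rVert$. For a functional $\lVert\cdot\rVert_X:M\to[0,\infty]$ with $X=\{f\in M:\lVert f\rVert_X<\infty\}$, the associate functional is $\lVert f\rVert_{X'}=\sup_{g\in X}\frac{1}{\lVert g\rVert_X}\int_0^\infty|fg|\,d\lambda$ (with $\frac00=0$, $\frac a0=\infty$ for $a>0$) and the associate space is $X'=\{f\in M:\lVert f\rVert_{X'}<\infty\}$. (The associate functional of an r.i. Banach function norm is again an r.i. Banach function norm.) For r.i. Banach function norms $\lVert\cdot\rVert_A,\lVert\cdot\rVert_B$: $\lVert f\rVert_{WL(A,B)}=\lVert f^*\chi_{[0,1]}\rVert_A+\lVert f^*\chi_{(1,\infty)}\rVert_B$ for $f\in M$, and $WL(A,B)=\{f\in M:\lVert f\rVert_{WL(A,B)}<\infty\}$. *)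

theory Defs
  imports "HOL-Analysis.Analysis"
begin

section \<open>Extended complex-valued measurable functions on the half-line\<close>

datatype ecomplex = Cplx complex | CInf

text \<open>The Borel sets of the one-point compactification of the complex plane.\<close>

definition ecomplex_borel :: "ecomplex measure" where
  "ecomplex_borel = sigma UNIV (insert {CInf} ((`) Cplx ` sets borel))"

fun ecmod :: "ecomplex \<Rightarrow> ennreal" where
  "ecmod (Cplx z) = ennreal (cmod z)"
| "ecmod CInf = \<infinity>"

definition ecomplex_of_ennreal :: "ennreal \<Rightarrow> ecomplex" where
  "ecomplex_of_ennreal x = (if x = \<infinity> then CInf else Cplx (complex_of_real (enn2real x)))"

text \<open>Functions have type \<^typ>\<open>real \<Rightarrow> ecomplex\<close>, but only their values on \<open>[0,\<infinity>)\<close> matter. Functions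
  equal almost everywhere are not identified; property (P2) below forces a Banach function norm to
  respect almost-everywhere equality.\<close>

abbreviation halfline :: "real measure" where
  "halfline \<equiv> lebesgue_on {0..}"

definition M :: "(real \<Rightarrow> ecomplex) set" where
  "M = measurable halfline ecomplex_borel"

text \<open>The non-negative functions are represented as \<^typ>\<open>ennreal\<close>-valued functions, which become
  elements of \<^const>\<open>M\<close> via \<open>emb\<close>.\<close>

definition M_plus :: "(real \<Rightarrow> ennreal) set" where
  "M_plus = borel_measurable halfline"

definition emb :: "(real \<Rightarrow> ennreal) \<Rightarrow> real \<Rightarrow> ecomplex" where
  "emb f = (\<lambda>t. ecomplex_of_ennreal (f t))"

text \<open>Since \<open>Inf {} = \<infinity>\<close> in \<^typ>\<open>ennreal\<close>, the value at \<open>t\<close> is infinite if no admissible \<open>s\<close> exists.\<close>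

definition rearrangement :: "(real \<Rightarrow> ecomplex) \<Rightarrow> real \<Rightarrow> ennreal" where
  "rearrangement f t =
     (INF s\<in>{s::real. 0 \<le> s \<and>
        emeasure halfline {x\<in>space halfline. ecmod (f x) > ennreal s} \<le> ennreal t}. ennreal s)"


section \<open>Rearrangement-invariant Banach function norms\<close>

locale banach_function_norm =
  fixes N :: "(real \<Rightarrow> ecomplex) \<Rightarrow> ennreal"
  assumes norm_modulus: "\<And>f. f \<in> M \<Longrightarrow> N (emb (\<lambda>t. ecmod (f t))) = N f"
    and P1_homogeneous:
      "\<And>f a. f \<in> M_plus \<Longrightarrow> 0 \<le> a \<Longrightarrow> N (emb (\<lambda>t. ennreal a * f t)) = ennreal a * N (emb f)"
    and P1_definite: "\<And>f. f \<in> M_plus \<Longrightarrow> N (emb f) = 0 \<longleftrightarrow> (AE t in halfline. f t = 0)"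
    and P1_triangle:
      "\<And>f g. f \<in> M_plus \<Longrightarrow> g \<in> M_plus \<Longrightarrow> N (emb (\<lambda>t. f t + g t)) \<le> N (emb f) + N (emb g)"
    and P2: "\<And>f g. f \<in> M_plus \<Longrightarrow> g \<in> M_plus \<Longrightarrow>
      (AE t in halfline. f t \<le> g t) \<Longrightarrow> N (emb f) \<le> N (emb g)"
    and P3: "\<And>F f. (\<And>n::nat. F n \<in> M_plus) \<Longrightarrow> f \<in> M_plus \<Longrightarrow>
      (AE t in halfline. incseq (\<lambda>n. F n t) \<and> (\<lambda>n. F n t) \<longlonglongrightarrow> f t) \<Longrightarrow>
      incseq (\<lambda>n. N (emb (F n))) \<and> (\<lambda>n. N (emb (F n))) \<longlonglongrightarrow> N (emb f)"
    and P4: "\<And>E. E \<in> sets halfline \<Longrightarrow> emeasure halfline E < \<infinity> \<Longrightarrow>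
      N (emb (indicator E)) < \<infinity>"
    and P5: "\<And>E. E \<in> sets halfline \<Longrightarrow> emeasure halfline E < \<infinity> \<Longrightarrow>
      \<exists>C<\<infinity>. \<forall>f\<in>M_plus. (\<integral>\<^sup>+t\<in>E. f t \<partial>halfline) \<le> C * N (emb f)"

locale ri_banach_function_norm = banach_function_norm +
  assumes rearrangement_invariant:
    "\<And>f g. f \<in> M \<Longrightarrow> g \<in> M \<Longrightarrow> (\<And>t. 0 \<le> t \<Longrightarrow> rearrangement f t = rearrangement g t) \<Longrightarrow> N f = N g"


section \<open>Associate functionals and Wiener--Luxemburg amalgam functionals\<close>

definition functional_space :: "((real \<Rightarrow> ecomplex) \<Rightarrow> ennreal) \<Rightarrow> (real \<Rightarrow> ecomplex) set" where
  "functional_space N = {f\<in>M. N f < \<infinity>}"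

text \<open>Division in \<^typ>\<open>ennreal\<close> satisfies \<open>0 / 0 = 0\<close> and \<open>a / 0 = \<infinity>\<close> for \<open>a > 0\<close>, and
  \<open>0 * \<infinity> = 0\<close>, as in measure theory.\<close>

definition associate ::
  "((real \<Rightarrow> ecomplex) \<Rightarrow> ennreal) \<Rightarrow> (real \<Rightarrow> ecomplex) \<Rightarrow> ennreal" where
  "associate N f =
     (SUP g\<in>functional_space N. (\<integral>\<^sup>+t. ecmod (f t) * ecmod (g t) \<partial>halfline) / N g)"

definition WL :: "((real \<Rightarrow> ecomplex) \<Rightarrow> ennreal) \<Rightarrow> ((real \<Rightarrow> ecomplex) \<Rightarrow> ennreal) \<Rightarrow>
    (real \<Rightarrow> ecomplex) \<Rightarrow> ennreal" where
  "WL A B f = A (emb (\<lambda>t. rearrangement f t * indicator {0..1} t))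
            + B (emb (\<lambda>t. rearrangement f t * indicator {1<..} t))"

end

theory Submission imports Defs begin

text \<open>The first inequality is Hardy--Littlewood, \<open>\<integral> |f g| \<le> \<integral> f\<^sup>* g\<^sup>*\<close>, followed by Hoelder on \<open>[0,1]\<close>
  and on \<open>(1,\<infinity>)\<close>. For the second, resonance of the half-line gives \<open>\<integral> f\<^sup>* h \<le> \<parallel>f\<parallel> \<cdot> W(h)\<close> for every
  non-increasing \<open>h\<close>, where \<open>\<parallel>f\<parallel>\<close> is the associate norm of \<open>f\<close> and
  \<open>W(h) = \<parallel>h \<chi>\<^bsub>[0,1]\<^esub>\<parallel> + \<parallel>h \<chi>\<^bsub>(1,\<infinity>)\<^esub>\<parallel>\<close>. The local part of the norm of \<open>f\<close> is tested against
  \<open>h = (g \<chi>\<^bsub>[0,1]\<^esub>)\<^sup>*\<close>. For the global part put \<open>k = (g \<chi>\<^bsub>(1,\<infinity>)\<^esub>)\<^sup>*\<close> and take \<open>h = k\<close> on \<open>(1,\<infinity>)\<close> and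
  \<open>h = \<integral>\<^sub>0\<^sup>1 k\<close> on \<open>[0,1]\<close>; this constant dominates \<open>k(1)\<close>, so \<open>h\<close> is non-increasing, and by (P5) it is
  controlled by the norm of \<open>g\<close> in \<open>B\<close>.\<close>

section \<open>Measurability of moduli, embeddings and monotone functions\<close>

lemma ecmod_measurable [measurable]: "ecmod \<in> ecomplex_borel \<rightarrow>\<^sub>M borel"
proof (rule measurableI)
  show "ecmod x \<in> space borel" for x by simp
  fix S :: "ennreal set" assume [measurable]: "S \<in> sets borel"
  let ?T = "{z. ennreal (cmod z) \<in> S}"
  have "?T \<in> sets borel"
    by measurable
  then have "Cplx ` ?T \<in> sets ecomplex_borel" "{CInf} \<in> sets ecomplex_borel"
    unfolding ecomplex_borel_def by (auto intro!: sigma_sets.Basic)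
  moreover have "ecmod -` S \<inter> space ecomplex_borel = Cplx ` ?T \<union> (if \<infinity> \<in> S then {CInf} else {})"
  proof -
    have "(ecmod x \<in> S) = (x \<in> Cplx ` ?T \<union> (if \<infinity> \<in> S then {CInf} else {}))" for x
      by (cases x) auto
    then show ?thesis
      by (auto simp: ecomplex_borel_def)
  qed
  ultimately show "ecmod -` S \<inter> space ecomplex_borel \<in> sets ecomplex_borel"
    by (cases "\<infinity> \<in> S") (simp_all only: if_True if_False Un_empty_right sets.Un)
qed

lemma ecomplex_of_ennreal_measurable [measurable]:
  "ecomplex_of_ennreal \<in> borel \<rightarrow>\<^sub>M ecomplex_borel"
  unfolding ecomplex_borel_def
proof (rule measurable_sigma_sets)
  fix Y assume "Y \<in> insert {CInf} ((`) Cplx ` sets borel)"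
  then consider "Y = {CInf}" | S where "S \<in> sets borel" "Y = Cplx ` S"
    by auto
  then show "ecomplex_of_ennreal -` Y \<inter> space borel \<in> sets borel"
  proof cases
    case 1
    then have "ecomplex_of_ennreal -` Y = {\<infinity>}"
      by (auto simp: ecomplex_of_ennreal_def split: if_splits)
    then show ?thesis by simp
  next
    case (2 S)
    have [measurable]: "S \<in> sets borel" by fact
    have "ecomplex_of_ennreal -` Y = {x. x \<noteq> \<infinity> \<and> complex_of_real (enn2real x) \<in> S}"
      using 2 by (auto simp: ecomplex_of_ennreal_def split: if_splits)
    then show ?thesis by simp
  qed
qed auto

lemma ecmod_ecomplex_of_ennreal [simp]: "ecmod (ecomplex_of_ennreal x) = x"
  by (simp add: ecomplex_of_ennreal_def ennreal_enn2real_if)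

lemma ecmod_emb [simp]: "ecmod (emb f t) = f t"
  by (simp add: emb_def)

lemma emb_in_M: "f \<in> M_plus \<Longrightarrow> emb f \<in> M"
  unfolding M_plus_def M_def emb_def by measurable

lemma ecmod_in_M_plus: "f \<in> M \<Longrightarrow> (\<lambda>t. ecmod (f t)) \<in> M_plus"
  unfolding M_plus_def M_def by measurable

text \<open>Superlevel sets of a non-increasing function are intervals.\<close>

lemma antimono_measurable:
  fixes h :: "real \<Rightarrow> ennreal"
  assumes "antimono h"
  shows "h \<in> borel_measurable borel"
proof (rule borel_measurableI_greater)
  fix y
  have "is_interval {x. y < h x}"
    unfolding is_interval_1 using assms by (auto simp: antimono_def intro: less_le_trans)
  then show "{x \<in> space borel. y < h x} \<in> sets borel"
    by (simp add: real_interval_borel_measurable)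
qed

lemma borel_in_M_plus: "f \<in> borel_measurable borel \<Longrightarrow> f \<in> M_plus"
  unfolding M_plus_def
  by (simp add: borel_measurable_if_I measurable_completion measurable_restrict_space1)

section \<open>Sigma-finiteness and layer-cake formulas\<close>

lemma sigma_finite_halfline: "sigma_finite_measure halfline"
proof
  have "(\<Union>n. {0..real n}) = {0..}"
    by (auto intro: real_arch_simple)
  then show "\<exists>\<A>. countable \<A> \<and> \<A> \<subseteq> sets halfline \<and> \<Union>\<A> = space halfline \<and> (\<forall>a\<in>\<A>. emeasure halfline a \<noteq> \<infinity>)"
    by (intro exI[of _ "range (\<lambda>n. {0..real n})"])
       (auto simp: sets_restrict_space_iff emeasure_restrict_space)
qed

lemma emeasure_ennreal_less: "emeasure lborel {s. 0 \<le> s \<and> ennreal s < y} = y"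
proof (cases y)
  case (real r)
  then have "{s. 0 \<le> s \<and> ennreal s < y} = {0..<r}"
    by (auto simp: ennreal_less_iff)
  with real show ?thesis by simp
next
  case top
  then have "{s. 0 \<le> s \<and> ennreal s < y} = {0..}"
    by auto
  moreover have "of_nat n \<le> emeasure lborel {0::real..}" for n
  proof -
    have "of_nat n = emeasure lborel {0..real n}"
      by (simp add: ennreal_of_nat_eq_real_of_nat)
    also have "\<dots> \<le> emeasure lborel {0::real..}"
      by (intro emeasure_mono) auto
    finally show ?thesis .
  qed
  then have "(SUP n. of_nat n) \<le> emeasure lborel {0::real..}"
    by (intro SUP_least)
  ultimately show ?thesis using top by (simp add: ennreal_SUP_of_nat_eq_top top_unique)
qed

text \<open>\<open>g x\<close> is the length of
  \<open>{s. 0 \<le> s \<and> ennreal s < g x}\<close>, and Fubini exchanges the two integrals.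
  Keeping \<open>f\<close> as a weight allows a second application in which an indicator is the
  weight and \<open>f\<close> is sliced.\<close>

lemma nn_integral_layer_right:
  assumes "sigma_finite_measure N" and [measurable]: "f \<in> borel_measurable N" "g \<in> borel_measurable N"
  shows "(\<integral>\<^sup>+x. f x * g x \<partial>N) =
    (\<integral>\<^sup>+s\<in>{0..}. (\<integral>\<^sup>+x. f x * indicator {x. ennreal s < g x} x \<partial>N) \<partial>lborel)"
proof -
  interpret N: sigma_finite_measure N by fact
  interpret pair_sigma_finite N lborel ..
  define k where "k = (\<lambda>(x, s). f x * indicator {s. 0 \<le> s \<and> ennreal s < g x} s)"
  have [measurable]: "k \<in> borel_measurable (N \<Otimes>\<^sub>M lborel)"
    unfolding k_def indicator_def mem_Collect_eq by measurable
  have "(\<integral>\<^sup>+s. k (x, s) \<partial>lborel) = f x * g x" for x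
    unfolding k_def prod.case by (subst nn_integral_cmult_indicator) (simp_all add: emeasure_ennreal_less)
  then have "(\<integral>\<^sup>+x. f x * g x \<partial>N) = (\<integral>\<^sup>+x. (\<integral>\<^sup>+s. k (x, s) \<partial>lborel) \<partial>N)"
    by simp
  also have "\<dots> = (\<integral>\<^sup>+s. (\<integral>\<^sup>+x. k (x, s) \<partial>N) \<partial>lborel)"
    by (rule Fubini[symmetric]) simp
  also have "\<dots> = (\<integral>\<^sup>+s\<in>{0..}. (\<integral>\<^sup>+x. f x * indicator {x. ennreal s < g x} x \<partial>N) \<partial>lborel)"
    by (intro nn_integral_cong) (auto simp: k_def indicator_def intro!: nn_integral_cong)
  finally show ?thesis .
qed

text \<open>Reduces comparisons of integrals of products to comparisons of the measures of
  intersected superlevel sets; both Hardy--Littlewood and resonance are proved in this way.\<close>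

lemma nn_integral_layer_cake:
  assumes "sigma_finite_measure N" and [measurable]: "f \<in> borel_measurable N" "g \<in> borel_measurable N"
  shows "(\<integral>\<^sup>+x. f x * g x \<partial>N) =
    (\<integral>\<^sup>+s\<in>{0..}. (\<integral>\<^sup>+u\<in>{0..}. emeasure N {x\<in>space N. ennreal u < f x \<and> ennreal s < g x} \<partial>lborel) \<partial>lborel)"
proof -
  have "(\<integral>\<^sup>+x. f x * indicator {x. ennreal s < g x} x \<partial>N) =
      (\<integral>\<^sup>+u\<in>{0..}. emeasure N {x\<in>space N. ennreal u < f x \<and> ennreal s < g x} \<partial>lborel)" for s
  proof -
    have [measurable]: "(\<lambda>x. indicator {x. ennreal s < g x} x :: ennreal) \<in> borel_measurable N"
      unfolding indicator_def mem_Collect_eq by measurable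
    have "(\<integral>\<^sup>+x. f x * indicator {x. ennreal s < g x} x \<partial>N) = (\<integral>\<^sup>+x. indicator {x. ennreal s < g x} x * f x \<partial>N)"
      by (simp add: mult.commute)
    also have "\<dots> = (\<integral>\<^sup>+u\<in>{0..}. (\<integral>\<^sup>+x. indicator {x. ennreal s < g x} x * indicator {x. ennreal u < f x} x \<partial>N) \<partial>lborel)"
      by (rule nn_integral_layer_right) (use assms in auto)
    also have "\<dots> = (\<integral>\<^sup>+u\<in>{0..}. (\<integral>\<^sup>+x. indicator {x\<in>space N. ennreal u < f x \<and> ennreal s < g x} x \<partial>N) \<partial>lborel)"
      by (intro nn_integral_cong arg_cong2[where f="(*)"] refl) (auto simp: indicator_def intro!: nn_integral_cong)
    also have "\<dots> = (\<integral>\<^sup>+u\<in>{0..}. emeasure N {x\<in>space N. ennreal u < f x \<and> ennreal s < g x} \<partial>lborel)"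
      by (subst nn_integral_indicator) simp_all
    finally show ?thesis .
  qed
  then show ?thesis
    by (simp add: nn_integral_layer_right[OF assms])
qed

section \<open>Distribution functions, rearrangements and the Hardy--Littlewood inequality\<close>

definition distribution :: "(real \<Rightarrow> ennreal) \<Rightarrow> real \<Rightarrow> ennreal" where
  "distribution f s = emeasure halfline {x\<in>space halfline. ennreal s < f x}"

text \<open>The non-increasing rearrangement at the level of moduli, which avoids passing through
  \<open>emb\<close>.\<close>

definition rear :: "(real \<Rightarrow> ennreal) \<Rightarrow> real \<Rightarrow> ennreal" where
  "rear f t = (INF s\<in>{s. 0 \<le> s \<and> distribution f s \<le> ennreal t}. ennreal s)"

lemma rearrangement_eq_rear: "rearrangement f = rear (\<lambda>x. ecmod (f x))"
  by (simp add: fun_eq_iff rearrangement_def rear_def distribution_def)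

text \<open>A larger \<open>t\<close> admits more levels \<open>s\<close>. Since
  \<open>ennreal t\<close> is 0 for negative \<open>t\<close>, monotonicity holds on the whole real
  line, as \<open>antimono\<close> demands.\<close>

lemma antimono_rear: "antimono (rear f)"
  unfolding rear_def
  by (intro antimonoI INF_superset_mono) (auto elim!: order_trans intro!: ennreal_leI)

lemma rear_M_plus: "rear f \<in> M_plus"
  by (intro borel_in_M_plus antimono_measurable antimono_rear)

lemma superlevel_sets:
  "f \<in> M_plus \<Longrightarrow> {x\<in>space halfline. ennreal s < f x} \<in> sets halfline"
  unfolding M_plus_def by measurable

lemma distribution_mono:
  assumes "g \<in> M_plus" "\<And>x. 0 \<le> x \<Longrightarrow> f x \<le> g x" "s' \<le> s"
  shows "distribution f s \<le> distribution g s'"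
  unfolding distribution_def
proof (rule emeasure_mono)
  show "{x \<in> space halfline. ennreal s < f x} \<subseteq> {x \<in> space halfline. ennreal s' < g x}"
  proof (intro Collect_mono impI conjI; elim conjE)
    fix x assume "x \<in> space halfline" "ennreal s < f x"
    moreover have "ennreal s' \<le> ennreal s"
      by (rule ennreal_leI) fact
    ultimately show "ennreal s' < g x"
      using assms(2)[of x] by simp
  qed
qed (rule superlevel_sets[OF assms(1)])

lemma distribution_le_zero:
  assumes "f \<in> M_plus"
  shows "distribution f s \<le> distribution f 0"
proof (cases "0 \<le> s")
  case True
  then show ?thesis
    by (intro distribution_mono assms order_refl)
next
  case False
  then show ?thesis
    by (simp add: distribution_def ennreal_neg)
qed

text \<open>The superlevel sets at \<open>s + 1 / Suc n\<close> increase to the one at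
  \<open>s\<close>, so continuity of the measure from below applies.\<close>

lemma distribution_right_continuous:
  assumes f: "f \<in> M_plus" and s: "0 \<le> s"
  shows "distribution f s = (SUP n. distribution f (s + 1 / Suc n))"
proof -
  have "{x\<in>space halfline. ennreal s < f x} = (\<Union>n. {x\<in>space halfline. ennreal (s + 1 / Suc n) < f x})"
  proof -
    have "\<exists>n. ennreal (s + 1 / Suc n) < f x" if less: "ennreal s < f x" for x
    proof -
      obtain r where r: "ennreal s < ennreal r" "ennreal r < f x" "0 \<le> r"
        using dense[OF less] by (metis ennreal_cases not_top_less)
      then have "s < r"
        using s by (simp add: ennreal_less_iff)
      then obtain n where "1 / Suc n < r - s"
        using nat_approx_posE[of "r - s"] by auto
      then have "ennreal (s + 1 / Suc n) \<le> ennreal r"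
        by (intro ennreal_leI) simp
      with r(2) show ?thesis by (auto intro: le_less_trans)
    qed
    moreover have "ennreal s < f x" if "ennreal (s + 1 / Suc n) < f x" for x n
    proof (rule le_less_trans[OF _ that])
      show "ennreal s \<le> ennreal (s + 1 / Suc n)"
        by (intro ennreal_leI) simp
    qed
    ultimately show ?thesis by auto
  qed
  moreover have "incseq (\<lambda>n. {x\<in>space halfline. ennreal (s + 1 / Suc n) < f x})"
  proof (intro incseq_SucI Collect_mono impI conjI; elim conjE)
    fix n x assume "ennreal (s + 1 / Suc n) < f x"
    then show "ennreal (s + 1 / Suc (Suc n)) < f x"
      by (rule le_less_trans[rotated]) (intro ennreal_leI, simp add: field_simps)
  qed simp
  moreover have "range (\<lambda>n. {x\<in>space halfline. ennreal (s + 1 / Suc n) < f x}) \<subseteq> sets halfline"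
    by (intro image_subsetI superlevel_sets f)
  ultimately show ?thesis
    unfolding distribution_def by (simp only: SUP_emeasure_incseq)
qed

text \<open>A Galois connection: right-continuity of the distribution function makes the infimum
  defining \<open>rear\<close> attained. Facts on \<open>rear\<close> are deduced from facts on
  \<open>distribution\<close> through this equivalence.\<close>

lemma rear_le_iff:
  assumes f: "f \<in> M_plus" and s: "0 \<le> s"
  shows "rear f t \<le> ennreal s \<longleftrightarrow> distribution f s \<le> ennreal t"
proof
  assume "distribution f s \<le> ennreal t"
  then show "rear f t \<le> ennreal s"
    unfolding rear_def using s by (intro INF_lower) auto
next
  assume le: "rear f t \<le> ennreal s"
  have "distribution f (s + 1 / Suc n) \<le> ennreal t" for n
  proof -
    have "rear f t < ennreal (s + 1 / Suc n)"
      using s by (intro le_less_trans[OF le]) (simp add: ennreal_less_iff)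
    then obtain s' where s': "0 \<le> s'" "distribution f s' \<le> ennreal t" "ennreal s' < ennreal (s + 1 / Suc n)"
      unfolding rear_def by (auto simp: INF_less_iff)
    then have "s' \<le> s + 1 / Suc n"
      by (simp add: ennreal_less_iff)
    then show ?thesis
      using distribution_mono[OF f order_refl] s'(2) by (blast intro: order_trans)
  qed
  then show "distribution f s \<le> ennreal t"
    by (simp add: distribution_right_continuous[OF f s] SUP_le_iff)
qed

text \<open>By the Galois connection the superlevel set of \<open>rear f\<close> at \<open>s\<close>
  is the interval from 0 to \<open>distribution f s\<close>, right end excluded.\<close>

lemma distribution_rear:
  assumes f: "f \<in> M_plus" and s: "0 \<le> s"
  shows "distribution (rear f) s = distribution f s"
proof -
  have "{t\<in>space halfline. ennreal s < rear f t} = {t. 0 \<le> t \<and> ennreal t < distribution f s}"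
    using rear_le_iff[OF f s] by (auto simp: not_le[symmetric])
  moreover have "emeasure halfline {t. 0 \<le> t \<and> ennreal t < d} = d" for d
  proof -
    have "{t. 0 \<le> t \<and> ennreal t < d} \<in> sets borel" by measurable
    then show ?thesis
      by (subst emeasure_restrict_space) (auto simp: emeasure_ennreal_less)
  qed
  ultimately show ?thesis
    by (simp add: distribution_def)
qed

text \<open>The set where \<open>h\<close> exceeds \<open>h t\<close> lies in \<open>{0..t}\<close>.
  Equality can fail at jumps, because \<open>h\<close> need not be right-continuous.\<close>

lemma rear_le_antimono:
  assumes h: "antimono h" and t: "0 \<le> t"
  shows "rear h t \<le> h t"
proof (cases "h t")
  case (real r)
  have "{x\<in>space halfline. ennreal r < h x} \<subseteq> {0..t}"
  proof safe
    fix x assume "x \<in> space halfline" "ennreal r < h x"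
    then show "x \<in> {0..t}"
      using antimonoD[OF h, of t x] real by (cases "t \<le> x") auto
  qed
  then have "distribution h r \<le> emeasure halfline {0..t}"
    unfolding distribution_def by (intro emeasure_mono) (auto simp: sets_restrict_space_iff)
  also have "\<dots> = ennreal t"
    using t by (simp add: emeasure_restrict_space)
  finally show ?thesis
    using rear_le_iff[OF borel_in_M_plus[OF antimono_measurable[OF h]]] real by simp
qed simp

lemma rear_mono_distribution:
  assumes "\<And>s. 0 \<le> s \<Longrightarrow> distribution f s \<le> distribution g s"
  shows "rear f t \<le> rear g t"
  unfolding rear_def by (intro INF_superset_mono Collect_mono) (auto intro: order_trans[OF assms])

text \<open>Superlevel sets of non-increasing functions are initial segments, so one of the two
  contains the other.\<close>

lemma emeasure_superlevel_Int_antimono: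
  assumes F: "antimono F" and G: "antimono G"
  shows "emeasure halfline {x\<in>space halfline. ennreal u < F x \<and> ennreal s < G x} =
    min (distribution F u) (distribution G s)"
proof -
  let ?A = "{x\<in>space halfline. ennreal u < F x}" and ?B = "{x\<in>space halfline. ennreal s < G x}"
  have eq: "{x\<in>space halfline. ennreal u < F x \<and> ennreal s < G x} = ?A \<inter> ?B" by auto
  have sets: "?A \<in> sets halfline" "?B \<in> sets halfline"
    by (intro superlevel_sets borel_in_M_plus antimono_measurable F G)+
  have "?A \<subseteq> ?B \<or> ?B \<subseteq> ?A"
  proof (rule ccontr)
    assume "\<not> (?A \<subseteq> ?B \<or> ?B \<subseteq> ?A)"
    then obtain x y where "ennreal u < F x" "\<not> ennreal s < G x" "ennreal s < G y" "\<not> ennreal u < F y"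
      by blast
    then show False
      using antimonoD[OF F, of y x] antimonoD[OF G, of x y] by (cases "x \<le> y") auto
  qed
  then show ?thesis
    unfolding eq distribution_def
    by (elim disjE) (use sets in \<open>auto simp: Int_absorb1 Int_absorb2 min_def antisym emeasure_mono\<close>)
qed

text \<open>An intersection is no larger than either set, and for \<open>F\<close> and
  \<open>G\<close> the smaller measure is attained. Arbitrary non-increasing majorants in
  distribution are allowed, so that a function which is already non-increasing can serve as its own
  majorant.\<close>

lemma Hardy_Littlewood:
  assumes f: "f \<in> M_plus" and g: "g \<in> M_plus" and F: "antimono F" and G: "antimono G"
    and fF: "\<And>s. 0 \<le> s \<Longrightarrow> distribution f s \<le> distribution F s"
    and gG: "\<And>s. 0 \<le> s \<Longrightarrow> distribution g s \<le> distribution G s"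
  shows "(\<integral>\<^sup>+x. f x * g x \<partial>halfline) \<le> (\<integral>\<^sup>+x. F x * G x \<partial>halfline)"
proof -
  have le: "emeasure halfline {x\<in>space halfline. ennreal u < f x \<and> ennreal s < g x} \<le>
      emeasure halfline {x\<in>space halfline. ennreal u < F x \<and> ennreal s < G x}" if "0 \<le> u" "0 \<le> s" for u s
    unfolding emeasure_superlevel_Int_antimono[OF F G]
  proof (rule min.boundedI)
    show "emeasure halfline {x\<in>space halfline. ennreal u < f x \<and> ennreal s < g x} \<le> distribution F u"
      by (rule order_trans[OF _ fF[OF that(1)]], unfold distribution_def, rule emeasure_mono)
         (use superlevel_sets[OF f] in auto)
    show "emeasure halfline {x\<in>space halfline. ennreal u < f x \<and> ennreal s < g x} \<le> distribution G s"
      by (rule order_trans[OF _ gG[OF that(2)]], unfold distribution_def, rule emeasure_mono)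
         (use superlevel_sets[OF g] in auto)
  qed
  have FG: "F \<in> M_plus" "G \<in> M_plus"
    using F G by (auto intro: borel_in_M_plus antimono_measurable)
  show ?thesis
    using f g FG unfolding M_plus_def
    by (subst (1 2) nn_integral_layer_cake[OF sigma_finite_halfline])
       (auto simp: indicator_def intro!: nn_integral_mono le[simplified])
qed

section \<open>Resonance of the half-line\<close>

text \<open>The rank \<open>distribution f (r x)\<close> is uniformly distributed over the support.
  At the critical level \<open>s0\<close>, right-continuity bounds the measure of
  \<open>{r > s0}\<close> by \<open>\<tau>\<close> from above, approach from below bounds that of
  \<open>{r \<ge> s0}\<close> by \<open>\<tau>\<close> from below, and the two sets differ by a null
  level set.\<close>

lemma emeasure_distribution_le:
  fixes r :: "real \<Rightarrow> real"
  defines "f \<equiv> \<lambda>x. ennreal (r x)"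
  assumes [measurable]: "r \<in> borel_measurable halfline" and nonneg: "\<And>x. 0 \<le> r x"
    and bounded: "\<And>x. r x \<le> K"
    and supp: "emeasure halfline {x\<in>space halfline. 0 < r x} < \<infinity>"
    and level: "\<And>s. 0 < s \<Longrightarrow> emeasure halfline {x\<in>space halfline. r x = s} = 0"
  shows "emeasure halfline {x\<in>space halfline. 0 < r x \<and> distribution f (r x) \<le> \<tau>} = min \<tau> (distribution f 0)"
proof -
  have f: "f \<in> M_plus"
    unfolding f_def M_plus_def by measurable
  have D: "distribution f s = emeasure halfline {x\<in>space halfline. s < r x}" if "0 \<le> s" for s
    using that by (simp add: distribution_def f_def ennreal_less_iff)
  have mono: "distribution f s \<le> distribution f s'" if "s' \<le> s" for s s'
    by (rule distribution_mono[OF f order_refl that])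
  have fin: "distribution f s < \<infinity>" for s
    using distribution_le_zero[OF f, of s] supp D[of 0] by (auto intro: le_less_trans)
  \<comment> \<open>\<open>S\<close> collects the levels of rank at most \<open>\<tau>\<close>; it
    contains \<open>K\<close>, above which \<open>r\<close> takes no values, so its infimum is
    meaningful.\<close>
  define S where "S = {s. 0 \<le> s \<and> distribution f s \<le> \<tau>}"
  define s0 where "s0 = Inf S"
  have K0: "0 \<le> K" using nonneg[of 0] bounded[of 0] by simp
  have empty: "{x\<in>space halfline. K < r x} = {}"
    using bounded by (auto simp: not_less)
  have "distribution f K = 0"
    unfolding D[OF K0] empty by simp
  then have "K \<in> S"
    using K0 by (simp add: S_def)
  have bdd: "bdd_below S"
    by (auto simp: S_def intro: bdd_belowI[of _ 0])
  have s0: "0 \<le> s0"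
    unfolding s0_def using \<open>K \<in> S\<close> by (intro cInf_greatest) (auto simp: S_def)
  have below: "\<tau> < distribution f s" if "0 \<le> s" "s < s0" for s
    using that cInf_lower[OF _ bdd, of s] by (force simp: s0_def S_def not_le[symmetric])
  have "distribution f (s0 + 1 / Suc n) \<le> \<tau>" for n
  proof -
    have "Inf S < s0 + 1 / Suc n" by (simp add: s0_def)
    then obtain s where "s \<in> S" "s < s0 + 1 / Suc n"
      using cInf_lessD[of S] \<open>K \<in> S\<close> by blast
    then show ?thesis
      using mono[of s "s0 + 1 / Suc n"] by (auto simp: S_def)
  qed
  then have le: "distribution f s0 \<le> \<tau>"
    by (simp add: distribution_right_continuous[OF f s0] SUP_le_iff)
  show ?thesis
  proof (cases "s0 = 0")
    \<comment> \<open>Here every point of the support has rank at most \<open>\<tau>\<close>, and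
      the minimum is the measure of the support.\<close>
    case True
    have "{x\<in>space halfline. 0 < r x \<and> distribution f (r x) \<le> \<tau>} = {x\<in>space halfline. 0 < r x}"
      using le mono[of 0] True by (auto intro: order_trans less_imp_le)
    then show ?thesis
      using le True by (simp add: D min_def)
  next
    case False
    with s0 have pos: "0 < s0" by simp
    have "{x\<in>space halfline. 0 < r x \<and> distribution f (r x) \<le> \<tau>} = {x\<in>space halfline. s0 \<le> r x}"
    proof (intro Collect_cong conj_cong refl iffI)
      fix x assume "0 < r x \<and> distribution f (r x) \<le> \<tau>"
      then show "s0 \<le> r x" using below[of "r x"] by (force simp: not_le[symmetric])
    next
      fix x assume "s0 \<le> r x"
      then show "0 < r x \<and> distribution f (r x) \<le> \<tau>"
        using pos mono[of s0 "r x"] le by (auto intro: order_trans)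
    qed
    moreover have "emeasure halfline {x\<in>space halfline. s0 \<le> r x} = distribution f s0"
    proof -
      have "{x\<in>space halfline. s0 \<le> r x} = {x\<in>space halfline. s0 < r x} \<union> {x\<in>space halfline. r x = s0}"
        by auto
      moreover have "{x\<in>space halfline. r x = s0} \<in> null_sets halfline"
        by (intro null_setsI level pos) measurable
      moreover have "{x\<in>space halfline. s0 < r x} \<in> sets halfline"
        by measurable
      ultimately show ?thesis
        by (simp only: D[OF s0] emeasure_Un_null_set)
    qed
    moreover have "\<tau> \<le> emeasure halfline {x\<in>space halfline. s0 \<le> r x}"
    proof -
      \<comment> \<open>Levels tending to \<open>s0\<close> strictly from below; the multiplicative
        form keeps them non-negative. Continuity from above is available because the support has
        finite measure.\<close>
      define a where "a n = s0 * (1 - 1 / Suc n)" for n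
      have a: "0 \<le> a n" "a n < s0" for n
        using pos by (auto simp: a_def mult_less_cancel_left1)
      have lim: "a \<longlonglongrightarrow> s0"
      proof -
        have "(\<lambda>n. s0 * (1 - inverse (real (Suc n)))) \<longlonglongrightarrow> s0 * (1 - 0)"
          by (intro tendsto_intros LIMSEQ_inverse_real_of_nat)
        then show ?thesis
          by (simp add: a_def[abs_def] inverse_eq_divide)
      qed
      have "s0 \<le> y" if "\<forall>n. a n < y" for y
        by (rule LIMSEQ_le_const2[OF lim]) (use that less_imp_le in blast)
      then have Inter: "(\<Inter>n. {x\<in>space halfline. a n < r x}) = {x\<in>space halfline. s0 \<le> r x}"
        using a(2) by (auto intro: less_le_trans)
      have "(INF n. emeasure halfline {x\<in>space halfline. a n < r x}) =
          emeasure halfline (\<Inter>n. {x\<in>space halfline. a n < r x})"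
      proof (rule INF_emeasure_decseq)
        show "range (\<lambda>n. {x\<in>space halfline. a n < r x}) \<subseteq> sets halfline"
          by (intro image_subsetI) measurable
        show "emeasure halfline {x\<in>space halfline. a n < r x} \<noteq> \<infinity>" for n
          using fin[of "a n"] by (simp only: D[OF a(1)] less_top infinity_ennreal_def not_False_eq_True)
        show "decseq (\<lambda>n. {x\<in>space halfline. a n < r x})"
        proof (intro decseq_SucI Collect_mono impI conjI; elim conjE)
          fix n x assume "a (Suc n) < r x"
          moreover have "a n \<le> a (Suc n)"
            unfolding a_def using pos by (intro mult_left_mono) (auto simp: field_simps)
          ultimately show "a n < r x" by simp
        qed simp
      qed
      moreover have "\<tau> \<le> (INF n. emeasure halfline {x\<in>space halfline. a n < r x})"
        using below a D by (intro INF_greatest) (metis less_imp_le)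
      ultimately show ?thesis by (simp only: Inter)
    qed
    ultimately show ?thesis
      using le mono[OF s0] by (auto simp: min_def simp del: space_lebesgue_on)
  qed
qed

text \<open>With \<open>D\<close> the distribution function of \<open>f\<close>, the map \<open>x \<mapsto> D (f x)\<close> ranks the points of the
  support of \<open>f\<close> and preserves measure, so \<open>g x = h (D (f x))\<close> arranges \<open>h\<close> in the order of \<open>f\<close>.\<close>

lemma resonance_no_plateaus:
  fixes r :: "real \<Rightarrow> real"
  defines "f \<equiv> \<lambda>x. ennreal (r x)"
  assumes r[measurable]: "r \<in> borel_measurable halfline" and nonneg: "\<And>x. 0 \<le> r x"
    and bounded: "\<And>x. r x \<le> K"
    and supp: "emeasure halfline {x\<in>space halfline. 0 < r x} < \<infinity>"
    and level: "\<And>s. 0 < s \<Longrightarrow> emeasure halfline {x\<in>space halfline. r x = s} = 0"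
    and h: "antimono h"
  obtains g where "g \<in> M_plus" "\<And>s. 0 \<le> s \<Longrightarrow> distribution g s \<le> distribution h s"
    "(\<integral>\<^sup>+x. rear f x * h x \<partial>halfline) \<le> (\<integral>\<^sup>+x. f x * g x \<partial>halfline)"
proof
  \<comment> \<open>\<open>supp\<close> makes the distribution function finite, so
    \<open>enn2real\<close> loses nothing. As a composition of two non-increasing maps,
    \<open>w\<close> is non-decreasing.\<close>
  define w where "w s = h (enn2real (distribution f s))" for s
  \<comment> \<open>Off the support the rank is constant on a set of infinite measure, so
    \<open>h\<close> cannot be transported there and \<open>g\<close> is set to 0.\<close>
  define g where "g = (\<lambda>x. if 0 < r x then w (r x) else 0)"
  have f: "f \<in> M_plus"
    unfolding f_def M_plus_def by measurable
  have mono: "distribution f s \<le> distribution f s'" if "s' \<le> s" for s s'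
    by (rule distribution_mono[OF f order_refl that])
  have fin: "distribution f s < \<infinity>" for s
    using distribution_le_zero[OF f, of s] supp by (auto simp: distribution_def f_def intro: le_less_trans)
  have w: "mono w"
    unfolding w_def using fin by (intro monoI antimonoD[OF h] enn2real_mono mono) (auto simp: less_top[symmetric])
  have [measurable]: "w \<in> borel_measurable borel"
  proof -
    have "(\<lambda>s. w (- s)) \<in> borel_measurable borel"
      using w by (intro antimono_measurable) (auto simp: antimono_def mono_def)
    from measurable_compose[OF _ this, of uminus borel] show ?thesis by simp
  qed
  show g: "g \<in> M_plus"
    unfolding g_def M_plus_def by measurable
  have hM: "h \<in> M_plus"
    by (intro borel_in_M_plus antimono_measurable h)
  \<comment> \<open>\<open>g\<close> has the distribution of \<open>h\<close>, capped by the measure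
    of the support of \<open>f\<close>: its superlevel set is caught between rank sets
    \<open>?E\<close>, whose measures are known.\<close>
  have Dg: "distribution g u = min (distribution h u) (distribution f 0)" if u: "0 \<le> u" for u
  proof -
    let ?G = "{x\<in>space halfline. ennreal u < g x}"
    let ?E = "\<lambda>\<tau>. {x\<in>space halfline. 0 < r x \<and> distribution f (r x) \<le> \<tau>}"
    note E = emeasure_distribution_le[OF r nonneg bounded supp level, folded f_def]
    have [measurable]: "distribution f \<in> borel_measurable borel"
      by (intro antimono_measurable antimonoI mono)
    have E_sets: "?E \<tau> \<in> sets halfline" for \<tau>
      by measurable
    have G_sets: "?G \<in> sets halfline"
      by (rule superlevel_sets[OF g])
    have fin_eq: "distribution f s = ennreal (enn2real (distribution f s))" for s
      using fin[of s] by simp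
    have interval: "emeasure halfline {0..t} = ennreal t" "{0..t} \<in> sets halfline" if "0 \<le> t" for t
      using that by (auto simp: emeasure_restrict_space sets_restrict_space_iff)
    \<comment> \<open>If \<open>h\<close> exceeds \<open>u\<close> at the rank of \<open>x\<close>,
      it does so on the whole interval from 0 to that rank.\<close>
    have "?G \<subseteq> ?E (distribution h u)"
    proof (intro Collect_mono impI; elim conjE; intro conjI)
      fix x assume x: "ennreal u < g x"
      then show "0 < r x"
        by (auto simp: g_def split: if_splits)
      then have "{0..enn2real (distribution f (r x))} \<subseteq> {x\<in>space halfline. ennreal u < h x}"
        using x antimonoD[OF h] by (auto simp: g_def w_def intro: less_le_trans)
      then have "emeasure halfline {0..enn2real (distribution f (r x))} \<le> distribution h u"
        unfolding distribution_def by (intro emeasure_mono superlevel_sets[OF hM])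
      then show "distribution f (r x) \<le> distribution h u"
        using interval(1) fin_eq by simp
    qed
    then have "distribution g u \<le> emeasure halfline (?E (distribution h u))"
      unfolding distribution_def[of g] by (rule emeasure_mono) (rule E_sets)
    then have "distribution g u \<le> min (distribution h u) (distribution f 0)"
      by (simp only: E)
    moreover have "min (distribution h u) (distribution f 0) \<le> distribution g u"
    \<comment> \<open>At rank exactly \<open>distribution h u\<close> the function \<open>h\<close>
      may already have dropped to \<open>u\<close> or lower, so only strictly smaller ranks are
      used.\<close>
    proof (rule dense_le)
      fix y assume y: "y < min (distribution h u) (distribution f 0)"
      have "?E y \<subseteq> ?G"
      proof (intro Collect_mono impI; elim conjE; intro conjI)
        fix x assume x: "0 < r x" "distribution f (r x) \<le> y"
        let ?t = "enn2real (distribution f (r x))"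
        show "ennreal u < g x"
        proof (rule ccontr)
          assume "\<not> ennreal u < g x"
          then have not: "\<not> ennreal u < h ?t"
            using x by (simp add: g_def w_def)
          have "{x\<in>space halfline. ennreal u < h x} \<subseteq> {0..?t}"
          proof safe
            fix z assume "z \<in> space halfline" "ennreal u < h z"
            then show "z \<in> {0..?t}"
              using not antimonoD[OF h, of ?t z] by (cases "?t \<le> z") auto
          qed
          then have "distribution h u \<le> emeasure halfline {0..?t}"
            unfolding distribution_def[of h] by (intro emeasure_mono interval) auto
          also have "\<dots> \<le> y"
            using x(2) interval(1) fin_eq by simp
          finally show False using y by (simp add: not_less[symmetric])
        qed
      qed
      then have "emeasure halfline (?E y) \<le> distribution g u"
        unfolding distribution_def[of g] by (rule emeasure_mono) (rule G_sets)
      then have "min y (distribution f 0) \<le> distribution g u"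
        by (simp only: E)
      then show "y \<le> distribution g u"
        using y by (simp add: min_absorb1)
    qed
    ultimately show ?thesis by (rule antisym)
  qed
  show "distribution g s \<le> distribution h s" if "0 \<le> s" for s
    by (simp add: Dg that)
  \<comment> \<open>\<open>g\<close> is a non-decreasing function of \<open>r\<close>, so superlevel
    sets of \<open>f\<close> and \<open>g\<close> are nested, like those of \<open>rear f\<close>
    and \<open>h\<close>. The cap in \<open>Dg\<close> does no harm, since
    \<open>distribution f s\<close> never exceeds it.\<close>
  have le: "emeasure halfline {x\<in>space halfline. ennreal s < rear f x \<and> ennreal u < h x} \<le>
      emeasure halfline {x\<in>space halfline. ennreal s < f x \<and> ennreal u < g x}" if su: "0 \<le> s" "0 \<le> u" for s u
  proof -
    let ?A = "{x\<in>space halfline. ennreal s < f x}" and ?B = "{x\<in>space halfline. ennreal u < g x}"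
    have eq: "{x\<in>space halfline. ennreal s < f x \<and> ennreal u < g x} = ?A \<inter> ?B" by auto
    have "?A \<subseteq> ?B \<or> ?B \<subseteq> ?A"
    proof (rule ccontr)
      assume "\<not> (?A \<subseteq> ?B \<or> ?B \<subseteq> ?A)"
      then obtain x y where "ennreal s < f x" "\<not> ennreal u < g x" "ennreal u < g y" "\<not> ennreal s < f y"
        by blast
      then show False
        using su(1) monoD[OF w, of "r y" "r x"] by (auto simp: f_def g_def ennreal_less_iff split: if_splits)
    qed
    then have "emeasure halfline (?A \<inter> ?B) = distribution f s \<or> emeasure halfline (?A \<inter> ?B) = distribution g u"
      unfolding distribution_def by (auto simp: Int_absorb1 Int_absorb2 simp del: space_lebesgue_on)
    moreover have "distribution f s \<le> distribution f 0"
      by (rule distribution_le_zero[OF f])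
    ultimately have "min (distribution f s) (distribution h u) \<le> emeasure halfline (?A \<inter> ?B)"
      using su by (auto simp: Dg min_def)
    then show ?thesis
      unfolding eq emeasure_superlevel_Int_antimono[OF antimono_rear h]
      by (simp add: distribution_rear f su)
  qed
  show "(\<integral>\<^sup>+x. rear f x * h x \<partial>halfline) \<le> (\<integral>\<^sup>+x. f x * g x \<partial>halfline)"
    using f g hM rear_M_plus[of f] unfolding M_plus_def
    by (subst (1 2) nn_integral_layer_cake[OF sigma_finite_halfline])
       (auto simp: indicator_def intro!: nn_integral_mono le[simplified])
qed

text \<open>Simple functions become injective on their support after multiplication by strictly decreasing
  factors, which here increase to one.\<close>

lemma plateau_free_approximation:
  assumes f: "f \<in> M_plus"
  obtains r :: "nat \<Rightarrow> real \<Rightarrow> real" and K where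
    "\<And>n. r n \<in> borel_measurable halfline" "\<And>n x. 0 \<le> r n x" "\<And>n x. r n x \<le> K n"
    "\<And>n. emeasure halfline {x\<in>space halfline. 0 < r n x} < \<infinity>"
    "\<And>n s. 0 < s \<Longrightarrow> emeasure halfline {x\<in>space halfline. r n x = s} = 0"
    "\<And>x. incseq (\<lambda>n. r n x)"
    "\<And>x. 0 \<le> x \<Longrightarrow> (\<lambda>n. ennreal (r n x)) \<longlonglongrightarrow> f x"
proof -
  from f obtain F where simple: "\<And>n. simple_function halfline (F n)" and inc: "incseq F"
    and fin: "\<And>n x. F n x < top" and sup: "\<And>x. (SUP n. F n x) = f x"
    unfolding M_plus_def by (rule borel_measurable_implies_simple_function_sequence') blast
  note [measurable] = borel_measurable_simple_function[OF simple]
  \<comment> \<open>Truncation to \<open>{0..real n}\<close> makes the support finite in measure;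
    the exponential is strictly decreasing in \<open>x\<close> and increases to 1 with
    \<open>n\<close>.\<close>
  define r where "r n x = (if 0 \<le> x \<and> x \<le> real n then enn2real (F n x) * exp (- (x + 1) / Suc n) else 0)" for n x
  \<comment> \<open>The inserted 0 covers the points removed by the truncation.\<close>
  define K where "K n = Max (insert 0 (enn2real ` F n ` space halfline))" for n
  show ?thesis
  proof (rule that[of r K])
    show "r n \<in> borel_measurable halfline" for n
    proof -
      have [measurable]: "(\<lambda>x. x) \<in> borel_measurable halfline"
        by (simp add: measurable_completion measurable_restrict_space1)
      show ?thesis
        unfolding r_def by measurable
    qed
    show "0 \<le> r n x" for n x
      by (simp add: r_def)
    have finite_range: "finite (F n ` space halfline)" for n
      using simple[of n] by (simp add: simple_function_def)
    show "r n x \<le> K n" for n x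
    proof (cases "0 \<le> x \<and> x \<le> real n")
      case True
      then have "r n x \<le> enn2real (F n x)"
        by (auto simp: r_def divide_nonpos_pos intro!: mult_left_le)
      also have "\<dots> \<le> K n"
        unfolding K_def using True finite_range by (intro Max_ge) auto
      finally show ?thesis .
    next
      case False
      then show ?thesis
        unfolding K_def using finite_range by (auto simp: r_def intro!: Max_ge)
    qed
    show "emeasure halfline {x\<in>space halfline. 0 < r n x} < \<infinity>" for n
    proof -
      have "emeasure halfline {x\<in>space halfline. 0 < r n x} \<le> emeasure halfline {0..real n}"
        by (intro emeasure_mono) (auto simp: r_def sets_restrict_space_iff split: if_splits)
      also have "\<dots> < \<infinity>"
        by (simp add: emeasure_restrict_space)
      finally show ?thesis .
    qed
    show "emeasure halfline {x\<in>space halfline. r n x = s} = 0" if s: "0 < s" for n s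
    proof -
      \<comment> \<open>On a level set with \<open>s > 0\<close>, equal values of \<open>F n\<close>
        force equal exponentials and hence equal points; \<open>F n\<close> takes only finitely many
        values.\<close>
      have "finite {x\<in>space halfline. r n x = s}"
      proof (rule finite_imageD)
        show "finite (F n ` {x\<in>space halfline. r n x = s})"
          by (rule finite_subset[OF _ finite_range[of n]]) auto
        show "inj_on (F n) {x\<in>space halfline. r n x = s}"
        proof (rule inj_onI, clarify)
          fix x y assume *: "F n x = F n y" "r n y = r n x" "s = r n x"
          then have "enn2real (F n x) * exp (- (x + 1) / Suc n) = enn2real (F n x) * exp (- (y + 1) / Suc n)"
              "enn2real (F n x) \<noteq> 0"
            using s by (auto simp: r_def split: if_splits)
          then show "x = y" by (simp add: divide_eq_eq)
        qed
      qed
      then have "{x\<in>space halfline. r n x = s} \<in> null_sets lebesgue"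
        by (intro null_sets_completionI finite_imp_null_set_lborel)
      then show ?thesis
        by (subst emeasure_restrict_space) (auto simp: null_sets_def)
    qed
    show "incseq (\<lambda>n. r n x)" for x
    proof (rule incseq_SucI)
      fix n
      have "enn2real (F n x) \<le> enn2real (F (Suc n) x)"
        using incseq_SucD[OF inc, of n] fin by (intro enn2real_mono) (auto simp: le_fun_def)
      moreover have "- (x + 1) / Suc n \<le> - (x + 1) / Suc (Suc n)" if "0 \<le> x"
        using that by (simp add: field_simps)
      ultimately show "r n x \<le> r (Suc n) x"
        by (auto simp: r_def intro!: mult_mono)
    qed
    show "(\<lambda>n. ennreal (r n x)) \<longlonglongrightarrow> f x" if x: "0 \<le> x" for x
    proof -
      have "(\<lambda>n. F n x) \<longlonglongrightarrow> f x"
        unfolding sup[symmetric] using inc by (intro LIMSEQ_SUP) (auto simp: incseq_def le_fun_def)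
      moreover have "(\<lambda>n. ennreal (exp (- (x + 1) / Suc n))) \<longlonglongrightarrow> ennreal (exp 0)"
      proof (intro tendsto_intros)
        have "(\<lambda>n. - (x + 1) * inverse (real (Suc n))) \<longlonglongrightarrow> - (x + 1) * 0"
          by (intro tendsto_intros LIMSEQ_inverse_real_of_nat)
        then show "(\<lambda>n. - (x + 1) / real (Suc n)) \<longlonglongrightarrow> 0"
          by (simp add: divide_inverse)
      qed
      ultimately have "(\<lambda>n. F n x * ennreal (exp (- (x + 1) / Suc n))) \<longlonglongrightarrow> f x * ennreal (exp 0)"
        by (intro tendsto_mult_ennreal) auto
      moreover have "eventually (\<lambda>n. F n x * ennreal (exp (- (x + 1) / Suc n)) = ennreal (r n x)) sequentially"
      proof (rule eventually_sequentiallyI)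
        fix n assume "nat \<lceil>x\<rceil> \<le> n"
        then have "x \<le> real n" by linarith
        then show "F n x * ennreal (exp (- (x + 1) / Suc n)) = ennreal (r n x)"
          using x fin[of n x] by (simp add: r_def ennreal_mult)
      qed
      ultimately show ?thesis
        by (auto elim: Lim_transform_eventually)
    qed
  qed
qed

text \<open>The plateau-free case is applied to increasing approximations of \<open>f\<close>, whose
  rearrangements increase to \<open>rear f\<close>. Their test functions are only dominated by
  \<open>h\<close> in distribution, because of the finite supports, which explains the form of
  \<open>bound\<close>.\<close>

lemma resonance:
  assumes f: "f \<in> M_plus" and h: "antimono h"
    and bound: "\<And>g. g \<in> M_plus \<Longrightarrow> (\<And>s. 0 \<le> s \<Longrightarrow> distribution g s \<le> distribution h s) \<Longrightarrow>
      (\<integral>\<^sup>+x. f x * g x \<partial>halfline) \<le> c"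
  shows "(\<integral>\<^sup>+x. rear f x * h x \<partial>halfline) \<le> c"
proof -
  from plateau_free_approximation[OF f] obtain r :: "nat \<Rightarrow> real \<Rightarrow> real" and K where
    r: "\<And>n. r n \<in> borel_measurable halfline" "\<And>n x. 0 \<le> r n x" "\<And>n x. r n x \<le> K n"
      "\<And>n. emeasure halfline {x\<in>space halfline. 0 < r n x} < \<infinity>"
      "\<And>n s. 0 < s \<Longrightarrow> emeasure halfline {x\<in>space halfline. r n x = s} = 0"
    and inc: "\<And>x. incseq (\<lambda>n. r n x)"
    and lim: "\<And>x. 0 \<le> x \<Longrightarrow> (\<lambda>n. ennreal (r n x)) \<longlonglongrightarrow> f x" by blast
  define F where "F n x = ennreal (r n x)" for n x
  have F: "F n \<in> M_plus" for n
    unfolding F_def M_plus_def using r(1)[of n] by measurable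
  have incF: "incseq (\<lambda>n. F n x)" for x
    using inc[of x] by (auto simp: F_def incseq_def ennreal_leI)
  have F_le: "F n x \<le> f x" if "0 \<le> x" for n x
    using incseq_le[OF incF] lim[OF that] by (simp add: F_def)
  have distribution: "(SUP n. distribution (F n) s) = distribution f s" for s
  proof -
    have "{x\<in>space halfline. ennreal s < f x} = (\<Union>n. {x\<in>space halfline. ennreal s < F n x})"
    proof -
      have "(ennreal s < f x) = (\<exists>n. ennreal s < F n x)" if "0 \<le> x" for x
      proof -
        have "f x = (SUP n. F n x)"
          using LIMSEQ_unique[OF lim[OF that] LIMSEQ_SUP[OF incF[of x], unfolded F_def]] by (simp add: F_def)
        then show ?thesis
          by (simp add: less_SUP_iff)
      qed
      then show ?thesis by auto
    qed
    moreover have "incseq (\<lambda>n. {x\<in>space halfline. ennreal s < F n x})"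
      using incF by (auto simp: incseq_def intro: less_le_trans)
    moreover have "range (\<lambda>n. {x\<in>space halfline. ennreal s < F n x}) \<subseteq> sets halfline"
      by (intro image_subsetI superlevel_sets F)
    ultimately show ?thesis
      unfolding distribution_def by (simp only: SUP_emeasure_incseq)
  qed
  have rear: "(SUP n. rear (F n) t) = rear f t" for t
  proof (rule antisym)
    show "(SUP n. rear (F n) t) \<le> rear f t"
      by (intro SUP_least rear_mono_distribution distribution_mono[OF f]) (auto intro: F_le)
    show "rear f t \<le> (SUP n. rear (F n) t)"
    proof (cases "SUP n. rear (F n) t")
      case (real l)
      have "rear (F n) t \<le> ennreal l" for n
        using SUP_upper[of n UNIV "\<lambda>n. rear (F n) t"] real by simp
      \<comment> \<open>Through \<open>rear_le_iff\<close>, convergence of the distribution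
        functions carries over to the rearrangements.\<close>
      then have "distribution (F n) l \<le> ennreal t" for n
        using rear_le_iff[OF F] real by simp
      then have "distribution f l \<le> ennreal t"
        unfolding distribution[symmetric] by (rule SUP_least)
      then show ?thesis
        using rear_le_iff[OF f] real by simp
    next
      case top
      then show ?thesis by (simp only: top_greatest)
    qed
  qed
  have incr: "incseq (\<lambda>n. rear (F n))"
    using incF by (auto simp: incseq_def le_fun_def intro!: rear_mono_distribution distribution_mono[OF F])
  have hM: "h \<in> M_plus"
    by (intro borel_in_M_plus antimono_measurable h)
  have "(\<integral>\<^sup>+x. rear f x * h x \<partial>halfline) = (\<integral>\<^sup>+x. (SUP n. rear (F n) x * h x) \<partial>halfline)"
    by (simp add: rear[symmetric] SUP_mult_right_ennreal)
  also have "\<dots> = (SUP n. \<integral>\<^sup>+x. rear (F n) x * h x \<partial>halfline)"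
    using incr hM rear_M_plus unfolding M_plus_def
    by (intro nn_integral_monotone_convergence_SUP) (auto simp: incseq_def le_fun_def intro!: mult_right_mono)
  also have "\<dots> \<le> c"
  proof (rule SUP_least)
    fix n
    obtain g where g: "g \<in> M_plus" "\<And>s. 0 \<le> s \<Longrightarrow> distribution g s \<le> distribution h s"
      "(\<integral>\<^sup>+x. rear (F n) x * h x \<partial>halfline) \<le> (\<integral>\<^sup>+x. F n x * g x \<partial>halfline)"
      using resonance_no_plateaus[OF r h, of n] by (auto simp: F_def[abs_def])
    note g(3)
    also have "(\<integral>\<^sup>+x. F n x * g x \<partial>halfline) \<le> (\<integral>\<^sup>+x. f x * g x \<partial>halfline)"
      by (intro nn_integral_mono mult_right_mono) (auto intro: F_le)
    also have "\<dots> \<le> c"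
      by (intro bound g)
    finally show "(\<integral>\<^sup>+x. rear (F n) x * h x \<partial>halfline) \<le> c" .
  qed
  finally show ?thesis .
qed

section \<open>Associate functionals\<close>

lemma (in banach_function_norm) norm_ecmod_mono:
  assumes "f \<in> M_plus" "g \<in> M" "\<And>t. 0 \<le> t \<Longrightarrow> f t \<le> ecmod (g t)"
  shows "N (emb f) \<le> N g"
  using P2[OF assms(1) ecmod_in_M_plus[OF assms(2)] AE_I2] assms(3)
  by (simp add: norm_modulus[OF assms(2)])

lemma (in banach_function_norm) norm_mono:
  assumes "f \<in> M_plus" "g \<in> M_plus" "\<And>t. 0 \<le> t \<Longrightarrow> f t \<le> g t"
  shows "N (emb f) \<le> N (emb g)"
  using assms by (intro norm_ecmod_mono emb_in_M) auto

text \<open>Supplies the degenerate case of Hoelder's inequality, on which the convention 0/0 = 0 in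
  the supremum gives no information.\<close>

lemma (in banach_function_norm) norm_null_integral:
  assumes g: "g \<in> M" and null: "N g = 0"
  shows "(\<integral>\<^sup>+t. k t * ecmod (g t) \<partial>halfline) = 0"
proof -
  have "AE t in halfline. ecmod (g t) = 0"
    using P1_definite[OF ecmod_in_M_plus[OF g]] norm_modulus[OF g] null by simp
  then have "(\<integral>\<^sup>+t. k t * ecmod (g t) \<partial>halfline) = (\<integral>\<^sup>+t. 0 \<partial>halfline)"
    by (intro nn_integral_cong_AE) auto
  then show ?thesis by simp
qed

lemma (in ri_banach_function_norm) norm_rear:
  assumes f: "f \<in> M_plus"
  shows "N (emb (rear f)) = N (emb f)"
proof (rule rearrangement_invariant)
  show "rearrangement (emb (rear f)) t = rearrangement (emb f) t" for t
    unfolding rearrangement_eq_rear ecmod_emb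
    by (intro antisym rear_mono_distribution) (simp_all add: distribution_rear[OF f])
qed (intro emb_in_M rear_M_plus f)+

text \<open>Stated for an arbitrary functional so that it also covers \<open>WL A B\<close>. If
  \<open>N g = 0\<close> the right-hand side is 0 even when the associate value is infinite, hence
  the side condition.\<close>

lemma associate_Hoelder:
  assumes g: "g \<in> functional_space N"
    and null: "N g = 0 \<Longrightarrow> (\<integral>\<^sup>+t. ecmod (f t) * ecmod (g t) \<partial>halfline) = 0"
  shows "(\<integral>\<^sup>+t. ecmod (f t) * ecmod (g t) \<partial>halfline) \<le> associate N f * N g"
proof (cases "N g = 0")
  case False
  let ?I = "\<integral>\<^sup>+t. ecmod (f t) * ecmod (g t) \<partial>halfline"
  have "N g < \<infinity>" using g by (simp add: functional_space_def)
  then have "?I = ?I / N g * N g"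
    using False by (simp add: ennreal_divide_times)
  also have "\<dots> \<le> associate N f * N g"
    unfolding associate_def by (intro mult_right_mono SUP_upper g) simp
  finally show ?thesis .
qed (simp add: null)

lemma associate_leI:
  assumes "\<And>g. g \<in> functional_space N \<Longrightarrow> (\<integral>\<^sup>+t. ecmod (f t) * ecmod (g t) \<partial>halfline) \<le> c * N g"
  shows "associate N f \<le> c"
  unfolding associate_def
proof (rule SUP_least)
  fix g assume "g \<in> functional_space N"
  from assms[OF this] show "(\<integral>\<^sup>+t. ecmod (f t) * ecmod (g t) \<partial>halfline) / N g \<le> c"
    by (cases "N g = 0") (auto intro!: divide_le_posI_ennreal simp: zero_less_iff_neq_zero mult.commute)
qed

lemma restricted_rear_M_plus:
  assumes "S \<in> sets borel"
  shows "(\<lambda>t. rear f t * indicator S t) \<in> M_plus"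
proof -
  have [measurable]: "rear f \<in> borel_measurable borel"
    by (intro antimono_measurable antimono_rear)
  show ?thesis
    using assms by (intro borel_in_M_plus borel_measurable_times_ennreal borel_measurable_indicator) simp_all
qed

lemma nn_integral_split_at_one:
  assumes "u \<in> M_plus"
  shows "(\<integral>\<^sup>+t. u t \<partial>halfline) =
    (\<integral>\<^sup>+t. u t * indicator {0..1} t \<partial>halfline) + (\<integral>\<^sup>+t. u t * indicator {1<..} t \<partial>halfline)"
proof -
  have [measurable]: "u \<in> borel_measurable halfline"
    using assms by (simp add: M_plus_def)
  have [measurable]: "{0..1} \<in> sets halfline" "{1<..} \<in> sets halfline"
    by (auto simp: sets_restrict_space_iff)
  have "(\<integral>\<^sup>+t. u t \<partial>halfline) = (\<integral>\<^sup>+t. u t * indicator {0..1} t + u t * indicator {1<..} t \<partial>halfline)"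
    by (intro nn_integral_cong) (auto simp: indicator_def)
  then show ?thesis
    by (simp add: nn_integral_add)
qed

lemma nn_integral_le_rear:
  assumes "f \<in> M_plus" "g \<in> M_plus"
  shows "(\<integral>\<^sup>+t. f t * g t \<partial>halfline) \<le> (\<integral>\<^sup>+t. rear f t * rear g t \<partial>halfline)"
  by (intro Hardy_Littlewood assms antimono_rear) (simp_all add: distribution_rear assms)

text \<open>Both parts of the rearrangement vanish almost everywhere by definiteness of
  \<open>A\<close> and \<open>B\<close>; Hardy--Littlewood against the constant 1 transfers this to
  the function itself.\<close>

lemma WL_null_integral:
  assumes A: "banach_function_norm A" and B: "banach_function_norm B"
    and g: "g \<in> M" and null: "WL A B g = 0"
  shows "(\<integral>\<^sup>+t. k t * ecmod (g t) \<partial>halfline) = 0"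
proof -
  interpret A: banach_function_norm A by fact
  interpret B: banach_function_norm B by fact
  let ?G = "\<lambda>t. ecmod (g t)"
  have G: "?G \<in> M_plus" by (rule ecmod_in_M_plus[OF g])
  have "AE t in halfline. rear ?G t * indicator {0..1} t = 0"
    using null A.P1_definite[OF restricted_rear_M_plus] by (simp add: WL_def rearrangement_eq_rear)
  moreover have "AE t in halfline. rear ?G t * indicator {1<..} t = 0"
    using null B.P1_definite[OF restricted_rear_M_plus] by (simp add: WL_def rearrangement_eq_rear)
  ultimately have "AE t in halfline. rear ?G t * 1 = 0"
    using AE_space by eventually_elim (auto simp: indicator_def split: if_splits)
  then have "(\<integral>\<^sup>+t. rear ?G t * 1 \<partial>halfline) = (\<integral>\<^sup>+t. 0 \<partial>halfline)"
    by (rule nn_integral_cong_AE)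
  moreover have "(\<integral>\<^sup>+t. ?G t * 1 \<partial>halfline) \<le> (\<integral>\<^sup>+t. rear ?G t * 1 \<partial>halfline)"
  proof (intro Hardy_Littlewood G antimono_rear)
    show "(\<lambda>_. 1) \<in> M_plus" by (simp add: M_plus_def)
    show "antimono (\<lambda>_::real. 1::ennreal)" by (simp add: antimono_def)
  qed (simp_all add: distribution_rear[OF G])
  ultimately have "(\<integral>\<^sup>+t. ?G t \<partial>halfline) = 0"
    by simp
  then have "AE t in halfline. ?G t = 0"
    using G by (simp add: M_plus_def nn_integral_0_iff_AE)
  then have "(\<integral>\<^sup>+t. k t * ecmod (g t) \<partial>halfline) = (\<integral>\<^sup>+t. 0 \<partial>halfline)"
    by (intro nn_integral_cong_AE) auto
  then show ?thesis by simp
qed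

text \<open>Every \<open>g\<close> dominated by \<open>h\<close> in distribution satisfies
  \<open>rear g t \<le> h t\<close> for \<open>t \<ge> 0\<close>, so its amalgam value is at most
  \<open>w\<close>; Hoelder then gives the bound that resonance requires.\<close>

lemma rear_pairing_le_associate_WL:
  fixes A B :: "(real \<Rightarrow> ecomplex) \<Rightarrow> ennreal"
  assumes A: "banach_function_norm A" and B: "banach_function_norm B"
    and f: "f \<in> M" and h: "antimono h"
    and AB: "A (emb (\<lambda>t. h t * indicator {0..1} t)) + B (emb (\<lambda>t. h t * indicator {1<..} t)) \<le> w" "w < \<infinity>"
  shows "(\<integral>\<^sup>+t. rear (\<lambda>x. ecmod (f x)) t * h t \<partial>halfline) \<le> associate (WL A B) f * w"
proof (rule resonance[OF ecmod_in_M_plus[OF f] h])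
  interpret A: banach_function_norm A by fact
  interpret B: banach_function_norm B by fact
  fix g assume g: "g \<in> M_plus" and gh: "\<And>s. 0 \<le> s \<Longrightarrow> distribution g s \<le> distribution h s"
  have [measurable]: "h \<in> borel_measurable borel"
    by (rule antimono_measurable[OF h])
  have le: "rear g t \<le> h t" if "0 \<le> t" for t
    using rear_mono_distribution[OF gh] rear_le_antimono[OF h that] by (rule order_trans)
  have "WL A B (emb g) \<le> A (emb (\<lambda>t. h t * indicator {0..1} t)) + B (emb (\<lambda>t. h t * indicator {1<..} t))"
    unfolding WL_def rearrangement_eq_rear ecmod_emb
    by (intro add_mono A.norm_mono B.norm_mono restricted_rear_M_plus borel_in_M_plus mult_right_mono le) auto
  also note AB(1)
  finally have WL: "WL A B (emb g) \<le> w" .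
  have "(\<integral>\<^sup>+t. ecmod (f t) * ecmod (emb g t) \<partial>halfline) \<le> associate (WL A B) f * WL A B (emb g)"
    using WL AB(2) emb_in_M[OF g]
    by (intro associate_Hoelder WL_null_integral[OF A B]) (auto simp: functional_space_def)
  also have "\<dots> \<le> associate (WL A B) f * w"
    by (intro mult_left_mono WL) simp
  finally show "(\<integral>\<^sup>+t. ecmod (f t) * g t \<partial>halfline) \<le> associate (WL A B) f * w"
    by simp
qed

lemma associate_local_part_le:
  assumes A: "ri_banach_function_norm A" and B: "ri_banach_function_norm B" and f: "f \<in> M"
  shows "associate A (emb (\<lambda>t. rearrangement f t * indicator {0..1} t)) \<le> associate (WL A B) f"
proof (rule associate_leI)
  interpret A: ri_banach_function_norm A by fact
  interpret B: ri_banach_function_norm B by fact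
  let ?F = "\<lambda>t. ecmod (f t)"
  fix g assume "g \<in> functional_space A"
  then have g: "g \<in> M" "A g < \<infinity>" by (auto simp: functional_space_def)
  \<comment> \<open>The pairing sees \<open>g\<close> only on \<open>{0..1}\<close>. Cutting first
    makes \<open>rear k\<close> vanish beyond 1, so the \<open>B\<close> part of the test function
    is 0.\<close>
  define k where "k t = ecmod (g t) * indicator {0..1} t" for t
  have sets: "{0..1} \<in> sets halfline"
    by (auto simp: sets_restrict_space_iff)
  then have k: "k \<in> M_plus"
    using ecmod_in_M_plus[OF g(1)] unfolding k_def M_plus_def by measurable
  have zero: "rear k t = 0" if "1 < t" for t
  proof -
    have "distribution k 0 \<le> emeasure halfline {0..1}"
      unfolding distribution_def by (intro emeasure_mono sets) (auto simp: k_def indicator_def split: if_splits)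
    also have "\<dots> \<le> ennreal t"
      using that by (simp add: emeasure_restrict_space)
    finally have "rear k t \<le> ennreal 0"
      using rear_le_iff[OF k, of 0 t] by simp
    then show ?thesis by simp
  qed
  have "A (emb (\<lambda>t. rear k t * indicator {0..1} t)) \<le> A (emb (rear k))"
    by (intro A.norm_mono restricted_rear_M_plus rear_M_plus) (auto simp: indicator_def)
  also have "\<dots> \<le> A g"
    unfolding A.norm_rear[OF k] by (intro A.norm_ecmod_mono k g) (auto simp: k_def indicator_def)
  finally have "A (emb (\<lambda>t. rear k t * indicator {0..1} t)) \<le> A g" .
  moreover have "(\<lambda>t. rear k t * indicator {1<..} t) = (\<lambda>t. 0)"
    by (auto simp: fun_eq_iff indicator_def zero)
  moreover have "B (emb (\<lambda>t. 0)) = 0"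
    by (subst B.P1_definite) (auto simp: M_plus_def)
  ultimately have "A (emb (\<lambda>t. rear k t * indicator {0..1} t)) + B (emb (\<lambda>t. rear k t * indicator {1<..} t)) \<le> A g"
    by simp
  then have *: "(\<integral>\<^sup>+t. rear ?F t * rear k t \<partial>halfline) \<le> associate (WL A B) f * A g"
    by (intro rear_pairing_le_associate_WL[OF A.banach_function_norm_axioms B.banach_function_norm_axioms f] antimono_rear g)
  have "(\<integral>\<^sup>+t. ecmod (emb (\<lambda>t. rearrangement f t * indicator {0..1} t) t) * ecmod (g t) \<partial>halfline) =
      (\<integral>\<^sup>+t. rear ?F t * k t \<partial>halfline)"
    by (intro nn_integral_cong) (simp add: k_def rearrangement_eq_rear mult_ac)
  also have "\<dots> \<le> (\<integral>\<^sup>+t. rear ?F t * rear k t \<partial>halfline)"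
    by (intro Hardy_Littlewood antimono_rear rear_M_plus k) (simp_all add: distribution_rear k)
  also note *
  finally show "(\<integral>\<^sup>+t. ecmod (emb (\<lambda>t. rearrangement f t * indicator {0..1} t) t) * ecmod (g t) \<partial>halfline)
      \<le> associate (WL A B) f * A g" .
qed

lemma associate_global_part_le:
  assumes A: "ri_banach_function_norm A" and B: "ri_banach_function_norm B"
  obtains C where "C < \<infinity>"
    "\<And>f. f \<in> M \<Longrightarrow> associate B (emb (\<lambda>t. rearrangement f t * indicator {1<..} t)) \<le> C * associate (WL A B) f"
proof -
  interpret A: ri_banach_function_norm A by fact
  interpret B: ri_banach_function_norm B by fact
  have unit: "{0..1} \<in> sets halfline" "emeasure halfline {0..1} = 1"
    by (auto simp: sets_restrict_space_iff emeasure_restrict_space)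
  obtain c where c: "c < \<infinity>" "\<And>k. k \<in> M_plus \<Longrightarrow> (\<integral>\<^sup>+t\<in>{0..1}. k t \<partial>halfline) \<le> c * B (emb k)"
    using B.P5[of "{0..1}"] unit by auto
  define a where "a = A (emb (indicator {0..1}))"
  have a: "a < \<infinity>"
    unfolding a_def using unit by (intro A.P4) auto
  show ?thesis
  \<comment> \<open>\<open>c * a\<close> is the cost of the constant piece on \<open>{0..1}\<close>,
    via (P5) for \<open>B\<close> and (P4) for \<open>A\<close>; the 1 is the cost of the
    tail.\<close>
  proof (rule that[of "c * a + 1"])
    show "c * a + 1 < \<infinity>"
      using c a by (simp add: ennreal_mult_less_top)
    fix f assume f: "f \<in> M"
    show "associate B (emb (\<lambda>t. rearrangement f t * indicator {1<..} t)) \<le> (c * a + 1) * associate (WL A B) f"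
    proof (rule associate_leI)
      let ?F = "rear (\<lambda>t. ecmod (f t))"
      fix g assume "g \<in> functional_space B"
      then have g: "g \<in> M" "B g < \<infinity>" by (auto simp: functional_space_def)
      define k where "k t = ecmod (g t) * indicator {1<..} t" for t
      have "{1<..} \<in> sets halfline"
        by (auto simp: sets_restrict_space_iff)
      then have k: "k \<in> M_plus"
        using ecmod_in_M_plus[OF g(1)] unfolding k_def M_plus_def by measurable
      define m where "m = (\<integral>\<^sup>+t\<in>{0..1}. rear k t \<partial>halfline)"
      define h where "h t = (if t \<le> 1 then m else rear k t)" for t
      have rear_k: "B (emb (rear k)) \<le> B g"
        unfolding B.norm_rear[OF k] by (intro B.norm_ecmod_mono k g) (auto simp: k_def indicator_def)
      have m: "m \<le> c * B g"
        unfolding m_def using c(2)[OF rear_M_plus] by (rule order_trans) (intro mult_left_mono rear_k, simp)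
      have m_fin: "m < \<infinity>"
        using m c(1) g(2) by (auto intro: le_less_trans simp: ennreal_mult_less_top)
      \<comment> \<open>On an interval of length 1 the integral of a non-increasing function is at
        least its value at the right end.\<close>
      have "rear k 1 = (\<integral>\<^sup>+t\<in>{0..1}. rear k 1 \<partial>halfline)"
        using unit by (simp add: nn_integral_cmult_indicator)
      also have "\<dots> \<le> m"
        unfolding m_def by (intro nn_integral_mono) (auto simp: indicator_def intro: antimonoD[OF antimono_rear])
      finally have m_ge: "rear k 1 \<le> m" .
      have h: "antimono h"
        using antimonoD[OF antimono_rear[of k]]
        by (intro antimonoI) (auto simp: h_def intro!: order_trans[OF _ m_ge])
      have "A (emb (\<lambda>t. h t * indicator {0..1} t)) = m * a"
      proof -
        \<comment> \<open>Homogeneity is available for real scalars, so the finite \<open>m\<close>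
          is converted.\<close>
        have "(\<lambda>t. h t * indicator {0..1} t) = (\<lambda>t. ennreal (enn2real m) * indicator {0..1} t)"
          using m_fin by (auto simp: fun_eq_iff h_def indicator_def)
        moreover have "indicator {0..1} \<in> M_plus"
          using unit(1) by (simp add: M_plus_def)
        ultimately show ?thesis
          using m_fin A.P1_homogeneous[of "indicator {0..1}" "enn2real m"] by (simp add: a_def)
      qed
      moreover have "B (emb (\<lambda>t. h t * indicator {1<..} t)) \<le> B g"
      proof -
        have "(\<lambda>t. h t * indicator {1<..} t) = (\<lambda>t. rear k t * indicator {1<..} t)"
          by (auto simp: fun_eq_iff h_def indicator_def)
        moreover have "B (emb (\<lambda>t. rear k t * indicator {1<..} t)) \<le> B (emb (rear k))"
          by (intro B.norm_mono restricted_rear_M_plus rear_M_plus) (auto simp: indicator_def)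
        ultimately show ?thesis using rear_k by simp
      qed
      ultimately have "A (emb (\<lambda>t. h t * indicator {0..1} t)) + B (emb (\<lambda>t. h t * indicator {1<..} t)) \<le> m * a + B g"
        by (simp add: add_left_mono)
      also have "\<dots> \<le> (c * a + 1) * B g"
        using mult_right_mono[OF m, of a] by (simp add: algebra_simps add_right_mono)
      finally have *: "(\<integral>\<^sup>+t. ?F t * h t \<partial>halfline) \<le> associate (WL A B) f * ((c * a + 1) * B g)"
        by (rule rear_pairing_le_associate_WL[OF A.banach_function_norm_axioms B.banach_function_norm_axioms f h])
           (use c a g in \<open>simp add: ennreal_mult_less_top\<close>)
      \<comment> \<open>The rearrangement of \<open>f\<close> cut to \<open>{1<..}\<close> need not
        be non-increasing. Capping at the value at 1 restores monotonicity and changes nothing on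
        \<open>{1<..}\<close>, where \<open>k\<close> lives.\<close>
      define F1 where "F1 t = min (?F t) (?F 1)" for t
      have F1: "antimono F1"
        unfolding F1_def using antimonoD[OF antimono_rear] by (intro antimonoI min.mono) auto
      have MF: "?F \<in> M_plus" "rear k \<in> M_plus" "F1 \<in> M_plus" "h \<in> M_plus"
        by (intro borel_in_M_plus antimono_measurable antimono_rear F1 h)+
      note [measurable] = MF[unfolded M_plus_def]
      have "(\<integral>\<^sup>+t. ecmod (emb (\<lambda>t. rearrangement f t * indicator {1<..} t) t) * ecmod (g t) \<partial>halfline) =
          (\<integral>\<^sup>+t. F1 t * k t \<partial>halfline)"
        using antimonoD[OF antimono_rear[of "\<lambda>t. ecmod (f t)"], of 1]
        by (intro nn_integral_cong) (auto simp: k_def F1_def rearrangement_eq_rear indicator_def min_def intro: antisym)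
      also have "\<dots> \<le> (\<integral>\<^sup>+t. F1 t * rear k t \<partial>halfline)"
        by (intro Hardy_Littlewood antimono_rear F1 MF k) (simp_all add: distribution_rear k)
      also have "\<dots> = (\<integral>\<^sup>+t. F1 t * rear k t * indicator {0..1} t \<partial>halfline) +
          (\<integral>\<^sup>+t. F1 t * rear k t * indicator {1<..} t \<partial>halfline)"
        by (rule nn_integral_split_at_one) (simp add: M_plus_def)
      also have "\<dots> \<le> (\<integral>\<^sup>+t. ?F t * h t * indicator {0..1} t \<partial>halfline) +
          (\<integral>\<^sup>+t. ?F t * h t * indicator {1<..} t \<partial>halfline)"
      proof (rule add_mono)
        \<comment> \<open>On \<open>{0..1}\<close> the cap replaces \<open>F1\<close> by the
          constant \<open>?F 1\<close>, and integrating \<open>rear k\<close> yields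
          \<open>m\<close>, the height of \<open>h\<close> there; finally
          \<open>?F t \<ge> ?F 1\<close>.\<close>
        have "(\<integral>\<^sup>+t. F1 t * rear k t * indicator {0..1} t \<partial>halfline) \<le>
            (\<integral>\<^sup>+t. ?F 1 * (rear k t * indicator {0..1} t) \<partial>halfline)"
          by (intro nn_integral_mono) (auto simp: F1_def indicator_def intro!: mult_right_mono)
        also have "\<dots> = ?F 1 * m"
          unfolding m_def using unit by (intro nn_integral_cmult) simp
        also have "\<dots> = (\<integral>\<^sup>+t. ?F 1 * m * indicator {0..1} t \<partial>halfline)"
          using unit by (simp add: nn_integral_cmult_indicator)
        also have "\<dots> \<le> (\<integral>\<^sup>+t. ?F t * h t * indicator {0..1} t \<partial>halfline)"
          by (intro nn_integral_mono)
             (auto simp: h_def indicator_def intro!: mult_right_mono antimonoD[OF antimono_rear])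
        finally show "(\<integral>\<^sup>+t. F1 t * rear k t * indicator {0..1} t \<partial>halfline) \<le>
            (\<integral>\<^sup>+t. ?F t * h t * indicator {0..1} t \<partial>halfline)" .
        show "(\<integral>\<^sup>+t. F1 t * rear k t * indicator {1<..} t \<partial>halfline) \<le>
            (\<integral>\<^sup>+t. ?F t * h t * indicator {1<..} t \<partial>halfline)"
          by (intro nn_integral_mono) (auto simp: F1_def h_def indicator_def intro!: mult_right_mono)
      qed
      also have "\<dots> = (\<integral>\<^sup>+t. ?F t * h t \<partial>halfline)"
        by (rule nn_integral_split_at_one[symmetric]) (simp add: M_plus_def)
      also note *
      finally show "(\<integral>\<^sup>+t. ecmod (emb (\<lambda>t. rearrangement f t * indicator {1<..} t) t) * ecmod (g t) \<partial>halfline)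
          \<le> (c * a + 1) * associate (WL A B) f * B g"
        by (simp add: mult_ac)
    qed
  qed
qed

section \<open>The Hoelder direction and the conclusion\<close>

lemma associate_WL_le:
  assumes A: "banach_function_norm A" and B: "banach_function_norm B" and f: "f \<in> M"
  shows "associate (WL A B) f \<le> WL (associate A) (associate B) f"
proof (rule associate_leI)
  interpret A: banach_function_norm A by fact
  interpret B: banach_function_norm B by fact
  fix g assume "g \<in> functional_space (WL A B)"
  then have g: "g \<in> M" and fin: "WL A B g < \<infinity>" by (auto simp: functional_space_def)
  let ?f0 = "emb (\<lambda>t. rearrangement f t * indicator {0..1} t)"
  let ?f1 = "emb (\<lambda>t. rearrangement f t * indicator {1<..} t)"
  let ?g0 = "emb (\<lambda>t. rearrangement g t * indicator {0..1} t)"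
  let ?g1 = "emb (\<lambda>t. rearrangement g t * indicator {1<..} t)"
  have M: "?g0 \<in> M" "?g1 \<in> M"
    unfolding rearrangement_eq_rear by (intro emb_in_M restricted_rear_M_plus; simp)+
  then have gs: "?g0 \<in> functional_space A" "?g1 \<in> functional_space B"
    using fin by (auto simp: functional_space_def WL_def)
  have "(\<integral>\<^sup>+t. ecmod (f t) * ecmod (g t) \<partial>halfline) \<le> (\<integral>\<^sup>+t. rearrangement f t * rearrangement g t \<partial>halfline)"
    unfolding rearrangement_eq_rear by (intro nn_integral_le_rear ecmod_in_M_plus f g)
  also have "\<dots> = (\<integral>\<^sup>+t. rearrangement f t * rearrangement g t * indicator {0..1} t \<partial>halfline) +
      (\<integral>\<^sup>+t. rearrangement f t * rearrangement g t * indicator {1<..} t \<partial>halfline)"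
    using rear_M_plus unfolding rearrangement_eq_rear
    by (intro nn_integral_split_at_one) (auto simp: M_plus_def)
  also have "\<dots> = (\<integral>\<^sup>+t. ecmod (?f0 t) * ecmod (?g0 t) \<partial>halfline) + (\<integral>\<^sup>+t. ecmod (?f1 t) * ecmod (?g1 t) \<partial>halfline)"
    by (intro arg_cong2[where f="(+)"] nn_integral_cong) (auto simp: indicator_def)
  also have "\<dots> \<le> associate A ?f0 * A ?g0 + associate B ?f1 * B ?g1"
    by (intro add_mono associate_Hoelder gs A.norm_null_integral B.norm_null_integral M)
  \<comment> \<open>Enlarging each associate factor to their sum lets it be factored out, so the
    constant is 1.\<close>
  also have "\<dots> \<le> WL (associate A) (associate B) f * A ?g0 + WL (associate A) (associate B) f * B ?g1"
    by (intro add_mono mult_right_mono) (auto simp: WL_def)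
  also have "\<dots> = WL (associate A) (associate B) f * WL A B g"
    by (simp add: WL_def distrib_left)
  finally show "(\<integral>\<^sup>+t. ecmod (f t) * ecmod (g t) \<partial>halfline) \<le> WL (associate A) (associate B) f * WL A B g" .
qed

theorem theorem3p5:
  fixes A B :: "(real \<Rightarrow> ecomplex) \<Rightarrow> ennreal"
  assumes "ri_banach_function_norm A" and "ri_banach_function_norm B"
  shows "(\<exists>C::real. C > 0 \<and>
            (\<forall>f\<in>M. associate (WL A B) f \<le> WL (associate A) (associate B) f \<and>
                   WL (associate A) (associate B) f \<le> ennreal C * associate (WL A B) f)) \<and>
         functional_space (associate (WL A B)) = functional_space (WL (associate A) (associate B))"
proof -
  have upper: "associate (WL A B) f \<le> WL (associate A) (associate B) f" if "f \<in> M" for f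
    using assms that by (intro associate_WL_le ri_banach_function_norm.axioms(1))
  obtain C where C: "C < \<infinity>"
    "\<And>f. f \<in> M \<Longrightarrow> associate B (emb (\<lambda>t. rearrangement f t * indicator {1<..} t)) \<le> C * associate (WL A B) f"
    using associate_global_part_le[OF assms] by blast
  \<comment> \<open>The summand 1 pays for the local part and \<open>C\<close> for the global
    part.\<close>
  define K where "K = 1 + enn2real C"
  have K: "ennreal K = 1 + C"
    using C(1) by (simp add: K_def ennreal_plus)
  have lower: "WL (associate A) (associate B) f \<le> ennreal K * associate (WL A B) f" if f: "f \<in> M" for f
  proof -
    have "WL (associate A) (associate B) f \<le> associate (WL A B) f + C * associate (WL A B) f"
      unfolding WL_def[of "associate A"] by (intro add_mono associate_local_part_le assms f C)
    then show ?thesis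
      by (simp add: K distrib_right)
  qed
  have "functional_space (associate (WL A B)) = functional_space (WL (associate A) (associate B))"
    unfolding functional_space_def
  proof (intro Collect_cong conj_cong refl iffI)
    fix f assume "f \<in> M" "associate (WL A B) f < \<infinity>"
    then show "WL (associate A) (associate B) f < \<infinity>"
      using lower[of f] by (auto intro: le_less_trans simp: ennreal_mult_less_top)
  next
    fix f assume "f \<in> M" "WL (associate A) (associate B) f < \<infinity>"
    then show "associate (WL A B) f < \<infinity>"
      using upper[of f] by (auto intro: le_less_trans)
  qed
  moreover have "0 < K"
    by (simp add: K_def add_pos_nonneg)
  ultimately show ?thesis
    using upper lower by blast
qed

end
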